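(* Let $L_\infty$ be the mixed labyrinth fractal generated by the sequence $\{\mathcal{A}_k\}_{k\ge1}$, where $\mathcal{A}_k$ is the $k$-th snake cross pattern. Then $\dim_B(L_\infty)=2$.
   Context: **Patterns and limit sets.** For $m\ge1$ and $0\le i,j\le m-1$ let $S_{i,j,m}=[\frac im,\frac{i+1}m]\times[\frac jm,\frac{j+1}m]$ (column $i$, row $j$) and $\mathcal{S}_m=\{S_{i,j,m}: 0\le i,j\le m-1\}$. A nonempty $\mathcal{A}\subseteq\mathcal{S}_m$ is an $m$-pattern of width $m$; its elements are called white squares. For a square $Q=[x,x+q]\times[y,y+q]\subseteq[0,1]^2$ let $P_Q(z_x,z_y)=(qz_x+x,qz_y+y)$. Given a sequence of patterns $\{\mathcal{A}_k\}_{k\ge1}$ of widths $m_k$, put $m(n)=\prod_{k=1}^n m_k$, $\mathcal{W}_1=\mathcal{A}_1$, and $\mathcal{W}_n=\{P_{W'}(W): W\in\mathcal{A}_n, W'\in\mathcal{W}_{n-1}\}\subseteq\mathcal{S}_{m(n)}$ for $n\ge2$ (white squares of level $n$); $L_n=\bigcup_{W\in\mathcal{W}_n}W$ and $L_\infty=\bigcap_{n\ge1}L_n$ is the limit set generated by the sequence (called a mixed labyrinth fractal when the patterns are labyrinth patterns, which is the case for the snake cross patterns below). $\dim_B$ denotes box counting dimension. **Snake cross patterns.** For $k\ge1$ the $k$-th snake cross pattern $\mathcal{A}_k$ has width $m_k=4k+7$. Denote by $(x,y)$ (integers, $|x|,|y|\le 2k+3$) the square $S_{2k+3+x,\,2k+3+y,\,4k+7}$,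 so $(0,0)$ is the central square. Put $x_0=0$ and $x_j=(-1)^{j+1}(2j-1)$ for $1\le j\le k$. The top arm consists of the squares: $(0,1),(0,2)$; for each $j=1,\dots,k$, all $(x,2j)$ with $x$ between $x_{j-1}$ and $x_j$ (inclusive), and $(x_j,2j+1),(x_j,2j+2)$; all $(x,2k+2)$ with $x$ between $0$ and $x_k$ (inclusive); and $(0,2k+3)$. The white squares of $\mathcal{A}_k$ are the central square, the top arm, and the images of the top arm under rotation by $90^\circ,180^\circ,270^\circ$ about the central square. *)

theory Defs
  imports "HOL-Analysis.Analysis"
begin

section \<open>Squares, patterns and limit sets\<close>

definition square :: "real \<Rightarrow> real \<Rightarrow> real \<Rightarrow> (real \<times> real) set" where
  "square x y q = {x..x + q} \<times> {y..y + q}"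

text \<open>\<open>cell i j m\<close> is the square in column \<open>i\<close> and row \<open>j\<close> (rows counted from the bottom) of
  the \<open>m \<times> m\<close> grid on the unit square.  The indices are integers, so that positions relative to
  the central cell need no truncated subtraction.\<close>

definition cell :: "int \<Rightarrow> int \<Rightarrow> nat \<Rightarrow> (real \<times> real) set" where
  "cell i j m = {of_int i / real m..(of_int i + 1) / real m} \<times>
                {of_int j / real m..(of_int j + 1) / real m}"

definition cells :: "nat \<Rightarrow> (real \<times> real) set set" where
  "cells m = {cell i j m | i j. 0 \<le> i \<and> i \<le> int m - 1 \<and> 0 \<le> j \<and> j \<le> int m - 1}"

definition is_pattern :: "nat \<Rightarrow> (real \<times> real) set set \<Rightarrow> bool" where
  "is_pattern m A \<longleftrightarrow> m \<ge> 1 \<and> A \<noteq> {} \<and> A \<subseteq> cells m"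

text \<open>The map from the unit square onto \<open>square x y q\<close>.\<close>

definition sq_map :: "real \<Rightarrow> real \<Rightarrow> real \<Rightarrow> real \<times> real \<Rightarrow> real \<times> real" where
  "sq_map x y q = (\<lambda>(zx, zy). (q * zx + x, q * zy + y))"

text \<open>Sequences of patterns are indexed from 1; the values \<open>A 0\<close> and \<open>white_squares A 0\<close> play no
  role below.  A square with \<open>q > 0\<close> determines its \<open>x\<close>, \<open>y\<close> and \<open>q\<close>, so each white square of the
  previous level contributes exactly one map.\<close>

fun white_squares :: "(nat \<Rightarrow> (real \<times> real) set set) \<Rightarrow> nat \<Rightarrow> (real \<times> real) set set" where
  "white_squares A 0 = {square 0 0 1}"
| "white_squares A (Suc 0) = A 1"
| "white_squares A (Suc (Suc n)) =
     {sq_map x y q ` W | x y q W.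
        W \<in> A (Suc (Suc n)) \<and> q > 0 \<and> square x y q \<in> white_squares A (Suc n)}"

definition level_set :: "(nat \<Rightarrow> (real \<times> real) set set) \<Rightarrow> nat \<Rightarrow> (real \<times> real) set" where
  "level_set A n = \<Union> (white_squares A n)"

definition limit_set :: "(nat \<Rightarrow> (real \<times> real) set set) \<Rightarrow> (real \<times> real) set" where
  "limit_set A = (\<Inter>n\<in>{1..}. level_set A n)"

section \<open>Snake cross patterns\<close>

definition snake_x :: "nat \<Rightarrow> int" where
  "snake_x j = (if j = 0 then 0 else (-1) ^ (j + 1) * (2 * int j - 1))"

definition int_between :: "int \<Rightarrow> int \<Rightarrow> int set" where
  "int_between a b = {min a b..max a b}"

definition top_arm :: "nat \<Rightarrow> (int \<times> int) set" where
  "top_arm k =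
     {(0, 1), (0, 2)}
     \<union> (\<Union>j\<in>{1..k}. int_between (snake_x (j - 1)) (snake_x j) \<times> {2 * int j}
          \<union> {(snake_x j, 2 * int j + 1), (snake_x j, 2 * int j + 2)})
     \<union> int_between 0 (snake_x k) \<times> {2 * int k + 2}
     \<union> {(0, 2 * int k + 3)}"

definition rot90 :: "int \<times> int \<Rightarrow> int \<times> int" where
  "rot90 = (\<lambda>(x, y). (- y, x))"

definition snake_cross_coords :: "nat \<Rightarrow> (int \<times> int) set" where
  "snake_cross_coords k = {(0, 0)} \<union> (\<Union>r\<in>{0..3::nat}. (rot90 ^^ r) ` top_arm k)"

definition snake_cross :: "nat \<Rightarrow> (real \<times> real) set set" where
  "snake_cross k =
     {cell (2 * int k + 3 + x) (2 * int k + 3 + y) (4 * k + 7) | x y.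
        (x, y) \<in> snake_cross_coords k}"

lemma abs_snake_x_le: "\<bar>snake_x j\<bar> \<le> 2 * int j"
  by (auto simp: snake_x_def abs_mult power_abs)

lemma top_arm_bounds:
  assumes "(x, y) \<in> top_arm k"
  shows "\<bar>x\<bar> \<le> 2 * int k + 3 \<and> \<bar>y\<bar> \<le> 2 * int k + 3"
proof -
  have *: "\<bar>snake_x j\<bar> \<le> 2 * int k" if "j \<le> k" for j
    using abs_snake_x_le[of j] that by linarith
  have **: "\<bar>x\<bar> \<le> 2 * int k" if "j \<le> k" "i \<le> k" "x \<in> int_between (snake_x i) (snake_x j)" for i j
    using *[OF that(1)] *[OF that(2)] that(3) by (auto simp: int_between_def)
  have ***: "\<bar>x\<bar> \<le> 2 * int k" if "x \<in> int_between 0 (snake_x k)"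
    using **[of k 0] that by (simp add: snake_x_def)
  have ax: "\<bar>x\<bar> \<le> 2 * int k + 3"
    if "j \<le> k" "x = snake_x j" for j
    using *[OF that(1)] that(2) by simp
  have bx: "\<bar>x\<bar> \<le> 2 * int k + 3"
    if "j \<le> k" "x \<in> int_between (snake_x (j - Suc 0)) (snake_x j)" for j
    using **[of j "j - Suc 0"] that by fastforce
  show ?thesis
    using assms unfolding top_arm_def by (auto dest: *** ax bx)
qed

lemma snake_cross_is_pattern: "is_pattern (4 * k + 7) (snake_cross k)"
proof -
  have rot: "\<bar>fst p\<bar> \<le> B \<and> \<bar>snd p\<bar> \<le> B"
    if "p \<in> (rot90 ^^ r) ` S" "\<And>x y. (x, y) \<in> S \<Longrightarrow> \<bar>x\<bar> \<le> B \<and> \<bar>y\<bar> \<le> B" for p r S and B :: int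
    using that(1)
  proof (induction r arbitrary: p)
    case 0
    then show ?case using that(2)[of "fst p" "snd p"] by simp
  next
    case (Suc r)
    then obtain q0 where "q0 \<in> S" "p = (rot90 ^^ Suc r) q0" by blast
    define q where "q = (rot90 ^^ r) q0"
    have "q \<in> (rot90 ^^ r) ` S" "p = rot90 q"
      using \<open>q0 \<in> S\<close> \<open>p = (rot90 ^^ Suc r) q0\<close> by (simp_all add: q_def)
    then show ?case using Suc.IH[of q] by (cases q) (simp add: rot90_def)
  qed
  have bounds: "\<bar>x\<bar> \<le> 2 * int k + 3 \<and> \<bar>y\<bar> \<le> 2 * int k + 3"
    if xy: "(x, y) \<in> snake_cross_coords k" for x y
  proof (cases "(x, y) = (0, 0)")
    case False
    then obtain r where "(x, y) \<in> (rot90 ^^ r) ` top_arm k"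
      using xy unfolding snake_cross_coords_def by blast
    from rot[OF this top_arm_bounds] show ?thesis by simp
  qed simp
  have "snake_cross k \<subseteq> cells (4 * k + 7)"
  proof
    fix W assume "W \<in> snake_cross k"
    then obtain x y where "(x, y) \<in> snake_cross_coords k"
      and W: "W = cell (2 * int k + 3 + x) (2 * int k + 3 + y) (4 * k + 7)"
      unfolding snake_cross_def by blast
    with bounds[of x y] show "W \<in> cells (4 * k + 7)"
      unfolding cells_def W
      by (intro CollectI exI[of _ "2 * int k + 3 + x"] exI[of _ "2 * int k + 3 + y"] conjI refl)
        linarith+
  qed
  moreover have "snake_cross k \<noteq> {}"
    by (auto simp: snake_cross_def snake_cross_coords_def)
  ultimately show ?thesis by (simp add: is_pattern_def)
qed

section \<open>Box counting dimension\<close>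

text \<open>The smallest number of sets of diameter at most \<open>d\<close> that cover \<open>F\<close>.  Boundedness is
  required explicitly because \<^const>\<open>diameter\<close> is meaningful only for bounded sets.\<close>

definition covering_number :: "real \<Rightarrow> 'a::metric_space set \<Rightarrow> nat" where
  "covering_number d F =
     (LEAST n. \<exists>C. finite C \<and> card C = n \<and> F \<subseteq> \<Union>C \<and> (\<forall>U\<in>C. bounded U \<and> diameter U \<le> d))"

text \<open>Box dimension is a notion for nonempty bounded sets, and it is defined only if the limit
  exists (that is, if the lower and the upper box dimension agree).\<close>

definition has_box_dimension :: "'a::metric_space set \<Rightarrow> real \<Rightarrow> bool" where
  "has_box_dimension F s \<longleftrightarrow>
     F \<noteq> {} \<and> bounded F \<and>
     ((\<lambda>d. ln (real (covering_number d F)) / (- ln d)) \<longlongrightarrow> s) (at_right 0)"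

end

theory Submission
  imports Defs "HOL-Real_Asymp.Real_Asymp"
begin

text \<open>
  The \<open>k\<close>-th snake cross fills about half of its \<open>(4 * k + 7) \<times> (4 * k + 7)\<close> grid, in any case at
  least a proportion \<open>c = 1 / 121\<close>: the horizontal runs of its top arm alone have at least
  \<open>1 + 3 + \<dots> + (2 * k - 1) = k\<^sup>2\<close> squares (\<open>card_snake_cross_ge\<close>).  Hence level \<open>n\<close> has at least
  \<open>c ^ n * M\<^sup>2\<close> white squares, where \<open>M\<close>, the product of the first \<open>n\<close> widths, is the reciprocal of
  their side length.  Since the widths grow, \<open>M \<ge> n!\<close>, and the loss \<open>c ^ n\<close> is negligible:
  \<open>n / ln M\<close> tends to \<open>0\<close>.  So on the logarithmic scale \<open>M\<^sup>2\<close> squares of side \<open>1 / M\<close> remain, which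
  is dimension \<open>2\<close>.

  To pass from white squares to coverings of the limit set, one uses that the central square of
  every snake cross is white.  The centre of a white square is then again the centre of a white
  square on every later level, and so belongs to the limit set (\<open>cell_centre_in_limit_set\<close>).
  Centres of distinct squares of level \<open>n\<close> are at distance at least \<open>1 / M\<close>, so a set of diameter
  below \<open>1 / M\<close> contains at most one of them, and the covering number at such a scale is at least
  the number of white squares (\<open>covering_number_lower\<close>).  For \<open>d\<close> between the side lengths of the
  levels \<open>n + 1\<close> and \<open>n\<close>, replacing \<open>- ln d\<close> by \<open>ln M\<close> costs at most the logarithm of the next width,
  which is also of smaller order than \<open>ln M\<close>.  The upper bound holds for every subset of the unit
  square, by covering it with a grid (\<open>unit_square_finite_cover\<close>).
\<close>

section \<open>Covering numbers\<close>

lemma covering_number_le_card: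
  assumes "finite C" "F \<subseteq> \<Union>C" "\<And>U. U \<in> C \<Longrightarrow> bounded U \<and> diameter U \<le> d"
  shows "covering_number d F \<le> card C"
  unfolding covering_number_def by (rule Least_le) (use assms in blast)

text \<open>Packing bounds covering from below: a set of diameter at most \<open>d\<close> cannot contain two points
  more than \<open>d\<close> apart.  Some finite cover has to be given, since otherwise the least element that
  defines the covering number is taken over the empty set.\<close>

lemma card_separated_le_covering_number:
  fixes F :: "'a::metric_space set"
  assumes cover: "finite C" "F \<subseteq> \<Union>C" "\<And>U. U \<in> C \<Longrightarrow> bounded U \<and> diameter U \<le> d"
    and P: "P \<subseteq> F" "\<And>p q. p \<in> P \<Longrightarrow> q \<in> P \<Longrightarrow> p \<noteq> q \<Longrightarrow> d < dist p q"
  shows "card P \<le> covering_number d F"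
proof -
  have "\<exists>n C. finite C \<and> card C = n \<and> F \<subseteq> \<Union>C \<and> (\<forall>U\<in>C. bounded U \<and> diameter U \<le> d)"
    using cover by blast
  from LeastI_ex[OF this] obtain D where D: "finite D" "card D = covering_number d F" "F \<subseteq> \<Union>D"
    "\<And>U. U \<in> D \<Longrightarrow> bounded U \<and> diameter U \<le> d"
    unfolding covering_number_def by blast
  have "\<forall>p\<in>P. \<exists>U\<in>D. p \<in> U"
    using D(3) P(1) by blast
  then obtain f where f: "\<And>p. p \<in> P \<Longrightarrow> f p \<in> D \<and> p \<in> f p"
    by metis
  have "inj_on f P"
  proof (rule inj_onI, rule ccontr)
    fix p q assume pq: "p \<in> P" "q \<in> P" "f p = f q" "p \<noteq> q"
    then have "dist p q \<le> diameter (f p)"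
      using f[of p] f[of q] D(4)[of "f p"] by (intro diameter_bounded_bound) auto
    also have "\<dots> \<le> d"
      using f D(4) pq by blast
    finally show False
      using P(2) pq by fastforce
  qed
  then have "card P \<le> card D"
    by (rule card_inj_on_le) (use f D(1) in auto)
  with D(2) show ?thesis by simp
qed

lemma cell_bounded_diameter:
  assumes "m > 0"
  shows "bounded (cell i j m) \<and> diameter (cell i j m) \<le> 2 / real m"
proof
  show "bounded (cell i j m)"
    unfolding cell_def by (intro bounded_Times) auto
  show "diameter (cell i j m) \<le> 2 / real m"
  proof (rule diameter_le)
    show "cell i j m \<noteq> {} \<or> 0 \<le> 2 / real m" by simp
    fix p q assume "p \<in> cell i j m" "q \<in> cell i j m"
    then have "\<bar>fst p - fst q\<bar> \<le> 1 / real m" "\<bar>snd p - snd q\<bar> \<le> 1 / real m"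
      by (auto simp: cell_def add_divide_distrib)
    moreover have "norm (p - q) \<le> \<bar>fst p - fst q\<bar> + \<bar>snd p - snd q\<bar>"
      using norm_Pair_le[of "fst (p - q)" "snd (p - q)"] by (cases p; cases q) simp
    ultimately show "norm (p - q) \<le> 2 / real m" by simp
  qed
qed

lemma finite_cells: "finite (cells m)" and card_cells_le: "card (cells m) \<le> m\<^sup>2"
proof -
  have eq: "cells m = (\<lambda>(i, j). cell i j m) ` ({0..int m - 1} \<times> {0..int m - 1})"
    unfolding cells_def by (rule set_eqI) (simp add: image_iff Bex_def, blast)
  show "finite (cells m)" unfolding eq by simp
  have "card (cells m) \<le> card ({0..int m - 1} \<times> {0..int m - 1})"
    unfolding eq by (rule card_image_le) simp
  then show "card (cells m) \<le> m\<^sup>2" by (simp add: power2_eq_square)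
qed

lemma unit_interval_grid:
  fixes x :: real
  assumes "0 \<le> x" "x \<le> 1" "m > 0"
  obtains i :: int where "0 \<le> i" "i \<le> int m - 1" "of_int i / real m \<le> x" "x \<le> (of_int i + 1) / real m"
proof -
  \<comment> \<open>The minimum only matters for \<open>x = 1\<close>, which belongs to the last interval.\<close>
  define i where "i = min (int m - 1) \<lfloor>x * m\<rfloor>"
  have le: "of_int i \<le> x * m" unfolding i_def by linarith
  have "x * m \<le> m" using assms by (simp add: mult_left_le_one_le)
  then have ge: "x * m \<le> of_int i + 1" unfolding i_def by linarith
  have "0 \<le> i" "i \<le> int m - 1" unfolding i_def using assms by auto
  with le ge show thesis
    by (intro that[of i]) (use assms in \<open>auto simp: field_simps\<close>)
qed

lemma unit_square_subset_cells:
  assumes "m > 0"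
  shows "{0..1} \<times> {0..1} \<subseteq> \<Union>(cells m)"
proof clarify
  fix x y :: real assume "x \<in> {0..1}" "y \<in> {0..1}"
  then obtain i j where "0 \<le> i" "i \<le> int m - 1" "of_int i / real m \<le> x" "x \<le> (of_int i + 1) / real m"
     "0 \<le> j" "j \<le> int m - 1" "of_int j / real m \<le> y" "y \<le> (of_int j + 1) / real m"
    using unit_interval_grid[of x m] unit_interval_grid[of y m] assms by (metis atLeastAtMost_iff)
  then show "(x, y) \<in> \<Union>(cells m)"
    unfolding cells_def by (intro UnionI[of "cell i j m"]) (auto simp: cell_def)
qed

lemma cells_subset_unit_square:
  assumes "m > 0"
  shows "\<Union>(cells m) \<subseteq> {0..1} \<times> {0..1}"
proof clarify
  fix x y :: real and W assume "W \<in> cells m" "(x, y) \<in> W"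
  then obtain i j where ij: "0 \<le> i" "i \<le> int m - 1" "0 \<le> j" "j \<le> int m - 1"
    and xy: "of_int i / real m \<le> x" "x \<le> (of_int i + 1) / real m"
      "of_int j / real m \<le> y" "y \<le> (of_int j + 1) / real m"
    unfolding cells_def by (auto simp: cell_def)
  have le1: "(of_int l + 1) / real m \<le> 1" if "l \<le> int m - 1" for l
    proof -
    have "of_int l + 1 \<le> real m" using that by linarith
    with assms show ?thesis by simp
  qed
  have ge0: "0 \<le> of_int l / real m" if "0 \<le> l" for l using that by simp
  show "x \<in> {0..1} \<and> y \<in> {0..1}"
    using xy le1[OF ij(2)] le1[OF ij(4)] ge0[OF ij(1)] ge0[OF ij(3)] by auto
qed

text \<open>The grid of width \<open>\<lceil>2 / d\<rceil>\<close> serves as the cover: its cells have diameter at most \<open>d\<close>, and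
  \<open>\<lceil>2 / d\<rceil> \<le> 3 / d\<close> because \<open>d \<le> 1\<close>.\<close>

lemma unit_square_finite_cover:
  fixes F :: "(real \<times> real) set"
  assumes "F \<subseteq> {0..1} \<times> {0..1}" "0 < d" "d \<le> 1"
  obtains C where "finite C" "F \<subseteq> \<Union>C" "\<And>U. U \<in> C \<Longrightarrow> bounded U \<and> diameter U \<le> d"
    "real (card C) \<le> 9 / d\<^sup>2"
proof -
  define m where "m = nat \<lceil>2 / d\<rceil>"
  have m: "2 / d \<le> real m" "real m \<le> 2 / d + 1"
    unfolding m_def using assms by (auto simp: of_nat_ceiling) 
  have "0 < 2 / d" using assms by simp
  with m have m0: "m > 0" by (metis less_le_trans of_nat_0_less_iff)
  have md: "2 / real m \<le> d" using m(1) m0 assms by (simp add: field_simps)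
  have "real m \<le> 3 / d" using m(2) assms by (simp add: field_simps)
  then have "(real m)\<^sup>2 \<le> (3 / d)\<^sup>2" by (intro power_mono) auto
  moreover have "real (card (cells m)) \<le> (real m)\<^sup>2"
    using card_cells_le[of m] by (metis of_nat_le_iff of_nat_power)
  moreover have "(3 / d)\<^sup>2 = 9 / d\<^sup>2" by (simp add: power_divide)
  ultimately have card: "real (card (cells m)) \<le> 9 / d\<^sup>2" by linarith
  show thesis
  proof (rule that[OF finite_cells _ _ card])
    show "F \<subseteq> \<Union>(cells m)" using unit_square_subset_cells[OF m0] assms(1) by blast
    fix U assume "U \<in> cells m"
    then obtain i j where "U = cell i j m" unfolding cells_def by blast
    then show "bounded U \<and> diameter U \<le> d" using cell_bounded_diameter[OF m0, of i j] md by simp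
  qed
qed

section \<open>Patterns with a white central square\<close>

lemma cell_eq_iff:
  assumes "m > 0"
  shows "cell i j m = cell i' j' m \<longleftrightarrow> i = i' \<and> j = j'"
  using assms by (auto simp: cell_def times_eq_iff Icc_eq_Icc divide_le_cancel)

text \<open>A substitution step acts on grid positions like adding a digit in the mixed radix system
  given by the widths.\<close>

lemma sq_map_cell:
  assumes "M > 0" "m > 0"
  shows "sq_map (of_int a / real M) (of_int b / real M) (1 / real M) ` cell i j m
    = cell (a * int m + i) (b * int m + j) (M * m)"
proof -
  have *: "(\<lambda>z. 1 / real M * z + of_int c / real M) ` {of_int l / real m..(of_int l + 1) / real m}
     = {of_int (c * int m + l) / real (M * m)..(of_int (c * int m + l) + 1) / real (M * m)}" for c l
    using assms by (subst image_affinity_atLeastAtMost) (auto simp: field_simps)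
  have "sq_map x y q ` (S \<times> T) = (\<lambda>z. q * z + x) ` S \<times> (\<lambda>z. q * z + y) ` T" for x y q S T
    unfolding sq_map_def by (auto simp: image_iff)
  then show ?thesis unfolding cell_def by (simp only: *)
qed

lemma square_eq_cell:
  "square (of_int a / real M) (of_int b / real M) (1 / real M) = cell a b M"
  by (simp add: square_def cell_def add_divide_distrib)

definition cell_centre :: "int \<Rightarrow> int \<Rightarrow> nat \<Rightarrow> real \<times> real" where
  "cell_centre i j m = ((of_int i + 1/2) / real m, (of_int j + 1/2) / real m)"

lemma cell_centre_in_cell: "cell_centre i j m \<in> cell i j m"
  by (auto simp: cell_centre_def cell_def divide_right_mono)

lemma dist_cell_centre:
  assumes "m > 0" "(i, j) \<noteq> (i', j')"
  shows "1 / real m \<le> dist (cell_centre i j m) (cell_centre i' j' m)"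
proof -
  have *: "1 / real m \<le> \<bar>(of_int a + 1/2) / real m - (of_int b + 1/2) / real m\<bar>" if "a \<noteq> b" for a b
  proof -
    have "(of_int a + 1/2) / real m - (of_int b + 1/2) / real m = of_int (a - b) / real m"
      by (simp add: diff_divide_distrib[symmetric])
    moreover have "1 \<le> \<bar>of_int (a - b) :: real\<bar>" using that by linarith
    ultimately show ?thesis using assms(1) by (simp add: abs_divide divide_right_mono)
  qed
  have "\<bar>fst p - fst q\<bar> \<le> dist p q" "\<bar>snd p - snd q\<bar> \<le> dist p q" for p q :: "real \<times> real"
    using dist_fst_le[of p q] dist_snd_le[of p q] by (auto simp: dist_real_def)
  from this[of "cell_centre i j m" "cell_centre i' j' m"] show ?thesis
    using assms(2) *[of i i'] *[of j j'] by (auto simp: cell_centre_def)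
qed

text \<open>An odd width \<open>2 * h k + 1\<close> makes \<open>(h k, h k)\<close> the position of the central cell, which shares
  its centre with the whole unit square.\<close>

locale centred_patterns =
  fixes A :: "nat \<Rightarrow> (real \<times> real) set set" and m h :: "nat \<Rightarrow> nat"
  assumes pattern: "k \<ge> 1 \<Longrightarrow> is_pattern (m k) (A k)"
    and odd_width: "k \<ge> 1 \<Longrightarrow> m k = 2 * h k + 1"
    and centre_white: "k \<ge> 1 \<Longrightarrow> cell (int (h k)) (int (h k)) (m k) \<in> A k"
begin

definition level_width :: "nat \<Rightarrow> nat" where "level_width n = (\<Prod>k=1..n. m k)"

definition pattern_index :: "nat \<Rightarrow> (int \<times> int) set" where
  "pattern_index k = {(i, j). i \<in> {0..int (m k) - 1} \<and> j \<in> {0..int (m k) - 1} \<and> cell i j (m k) \<in> A k}"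

text \<open>The positions of the white squares of level \<open>n\<close> in the grid of width \<open>level_width n\<close>.  Integer
  positions make counting white squares a matter of division with remainder.\<close>

primrec level_index :: "nat \<Rightarrow> (int \<times> int) set" where
  "level_index 0 = {(0, 0)}"
| "level_index (Suc n) = (\<lambda>((a, b), (i, j)). (a * int (m (Suc n)) + i, b * int (m (Suc n)) + j))
     ` (level_index n \<times> pattern_index (Suc n))"

lemma level_width_Suc: "level_width (Suc n) = level_width n * m (Suc n)" by (simp add: level_width_def)

lemma m_pos: "k \<ge> 1 \<Longrightarrow> m k > 0" by (simp add: odd_width)

lemma level_width_pos: "level_width n > 0" unfolding level_width_def by (intro prod_pos) (auto simp: m_pos)

lemma finite_pattern_index: "finite (pattern_index k)"
  by (rule finite_subset[of _ "{0..int (m k) - 1} \<times> {0..int (m k) - 1}"]) (auto simp: pattern_index_def)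

lemma card_le_card_pattern_index:
  assumes "k \<ge> 1"
  shows "card (A k) \<le> card (pattern_index k)"
proof -
  have "A k \<subseteq> (\<lambda>(i, j). cell i j (m k)) ` pattern_index k"
    using pattern[OF assms] by (force simp: is_pattern_def cells_def pattern_index_def)
  then show ?thesis by (meson finite_pattern_index surj_card_le)
qed

lemma finite_level_index: "finite (level_index n)" by (induction n) (auto simp: finite_pattern_index)

lemma card_level_index_Suc: "card (level_index (Suc n)) = card (level_index n) * card (pattern_index (Suc n))"
proof -
  have eqD: "a = a' \<and> i = i'" if "a * int l + i = a' * int l + i'" "i \<in> {0..int l - 1}" "i' \<in> {0..int l - 1}"
    for a a' i i' :: int and l
  proof -
    have "(a * int l + i) div int l = a" "(a' * int l + i') div int l = a'"
      using that(2,3) by auto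
    then have "a = a'" using that(1) by simp
    with that(1) show ?thesis by simp
  qed
  have "inj_on (\<lambda>((a, b), (i, j)). (a * int (m (Suc n)) + i, b * int (m (Suc n)) + j)) (level_index n \<times> pattern_index (Suc n))"
    by (rule inj_onI) (auto simp: pattern_index_def dest: eqD)
  then show ?thesis by (simp add: card_image card_cartesian_product)
qed

text \<open>The density of the white squares of level \<open>n\<close> is the product of the densities of the first
  \<open>n\<close> patterns.\<close>

lemma card_level_index_ge:
  assumes "c \<ge> 0" and dens: "\<And>k. k \<ge> 1 \<Longrightarrow> c * (real (m k))\<^sup>2 \<le> real (card (A k))"
  shows "c ^ n * (real (level_width n))\<^sup>2 \<le> real (card (level_index n))"
proof (induction n)
  case 0 then show ?case by (simp add: level_width_def)
next
  case (Suc n)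
  have "c * (real (m (Suc n)))\<^sup>2 \<le> real (card (pattern_index (Suc n)))"
    using dens[of "Suc n"] card_le_card_pattern_index[of "Suc n"] by simp
  then have "c ^ n * (real (level_width n))\<^sup>2 * (c * (real (m (Suc n)))\<^sup>2) \<le> real (card (level_index n)) * real (card (pattern_index (Suc n)))"
    using Suc assms(1) by (intro mult_mono) auto
  then show ?case by (simp add: card_level_index_Suc level_width_Suc power_mult_distrib mult_ac del: level_index.simps)
qed

lemma cell_in_white_squares: "(i, j) \<in> level_index n \<Longrightarrow> cell i j (level_width n) \<in> white_squares A n"
proof (induction n arbitrary: i j)
  case 0
  then show ?case using square_eq_cell[of 0 1 0] by (simp add: level_width_def)
next
  case (Suc n)
  then obtain a b i' j' where ab: "(a, b) \<in> level_index n" and ij: "(i', j') \<in> pattern_index (Suc n)"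
    and eq: "i = a * int (m (Suc n)) + i'" "j = b * int (m (Suc n)) + j'"
    by auto
  from ij have W: "cell i' j' (m (Suc n)) \<in> A (Suc n)" by (simp add: pattern_index_def)
  have sq: "square (of_int a / real (level_width n)) (of_int b / real (level_width n)) (1 / real (level_width n)) \<in> white_squares A n"
    using Suc.IH[OF ab] by (simp only: square_eq_cell)
  have im: "cell i j (level_width (Suc n)) =
    sq_map (of_int a / real (level_width n)) (of_int b / real (level_width n)) (1 / real (level_width n)) ` cell i' j' (m (Suc n))"
    by (simp add: sq_map_cell level_width_pos m_pos eq level_width_Suc)
  show ?case
  proof (cases n)
    case 0
    with ab eq W show ?thesis by (simp add: level_width_def)
  next
    case (Suc l)
    have "0 < 1 / real (level_width n)" using level_width_pos by simp
    with W sq show ?thesis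
      unfolding im unfolding Suc white_squares.simps
      by (intro CollectI exI conjI) (rule refl)
  qed
qed

text \<open>White squares are nested in the white squares of earlier levels; together with the next
  lemma this places a centre in the level sets both before and after its own level.\<close>

lemma cell_subset_level_set:
  assumes "(i, j) \<in> level_index (n + l)"
  shows "cell i j (level_width (n + l)) \<subseteq> level_set A n"
proof -
  have "\<exists>(a, b)\<in>level_index n. cell i j (level_width (n + l)) \<subseteq> cell a b (level_width n)"
    using assms
  proof (induction l arbitrary: i j)
    case 0 then show ?case by auto
  next
    case (Suc l)
    let ?m = "m (Suc (n + l))"
    from Suc.prems obtain a b i' j' where ab: "(a, b) \<in> level_index (n + l)" and ij: "(i', j') \<in> pattern_index (Suc (n + l))"
      and eq: "i = a * int ?m + i'" "j = b * int ?m + j'"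
      by auto
    have pos: "real ?m > 0" "real (level_width (n + l)) > 0" using level_width_pos m_pos by auto
    have *: "of_int c / real (level_width (n + l)) \<le> of_int (c * int ?m + t) / real (level_width (n + l) * ?m)"
      "(of_int (c * int ?m + t) + 1) / real (level_width (n + l) * ?m) \<le> (of_int c + 1) / real (level_width (n + l))"
      if "t \<in> {0..int ?m - 1}" for c t
    proof -
      have "0 \<le> real_of_int t" "real_of_int t \<le> real ?m - 1" using that by auto
      then show "of_int c / real (level_width (n + l)) \<le> of_int (c * int ?m + t) / real (level_width (n + l) * ?m)"
        "(of_int (c * int ?m + t) + 1) / real (level_width (n + l) * ?m) \<le> (of_int c + 1) / real (level_width (n + l))"
        using pos by (auto simp: divide_simps) (auto simp: algebra_simps)
    qed
    have "cell i j (level_width (n + Suc l)) \<subseteq> cell a b (level_width (n + l))"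
      using ij *[of i' a] *[of j' b] unfolding cell_def eq add_Suc_right level_width_Suc
      by (intro Sigma_mono) (auto simp: pattern_index_def)
    with Suc.IH[OF ab] show ?case by blast
  qed
  then show ?thesis unfolding level_set_def using cell_in_white_squares by blast
qed

text \<open>Choosing the central cell in each further pattern does not move the centre.\<close>

lemma cell_centre_refine:
  assumes "(i, j) \<in> level_index n"
  shows "\<exists>(i', j')\<in>level_index (n + l). cell_centre i' j' (level_width (n + l)) = cell_centre i j (level_width n)"
proof (induction l)
  case 0 then show ?case using assms by auto
next
  case (Suc l)
  then obtain a b where ab: "(a, b) \<in> level_index (n + l)" "cell_centre a b (level_width (n + l)) = cell_centre i j (level_width n)"
    by auto
  let ?k = "Suc (n + l)"
  have "(int (h ?k), int (h ?k)) \<in> pattern_index ?k"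
    using centre_white[of ?k] odd_width[of ?k] by (simp add: pattern_index_def)
  with ab(1) have "(a * int (m ?k) + int (h ?k), b * int (m ?k) + int (h ?k)) \<in> level_index ?k"
    by force
  moreover have "(of_int (c * int (m ?k) + int (h ?k)) + 1/2) / real (level_width ?k) = (of_int c + 1/2) / real (level_width (n + l))" for c
  proof -
    have "of_int (c * int (m ?k) + int (h ?k)) + 1/2 = (of_int c + 1/2) * real (m ?k)"
      by (simp add: odd_width algebra_simps)
    then show ?thesis using m_pos[of ?k] by (simp add: level_width_Suc)
  qed
  ultimately show ?case
    using ab(2) unfolding add_Suc_right by (intro bexI) (auto simp: cell_centre_def)
qed

lemma cell_centre_in_limit_set:
  assumes "(i, j) \<in> level_index n"
  shows "cell_centre i j (level_width n) \<in> limit_set A"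
  unfolding limit_set_def
proof
  fix l :: nat
  \<comment> \<open>Going down to level \<open>n + l\<close> treats the levels before and after \<open>n\<close> uniformly.\<close>
  obtain i' j' where ij: "(i', j') \<in> level_index (n + l)" and eq: "cell_centre i' j' (level_width (n + l)) = cell_centre i j (level_width n)"
    using cell_centre_refine[OF assms, of l] by auto
  show "cell_centre i j (level_width n) \<in> level_set A l"
    using cell_subset_level_set[of i' j' l n] ij cell_centre_in_cell[of i' j' "level_width (n + l)"] eq
    by (auto simp: add.commute)
qed

lemma limit_set_nonempty: "limit_set A \<noteq> {}"
  using cell_centre_in_limit_set[of 0 0 0] by auto

lemma limit_set_subset: "limit_set A \<subseteq> {0..1} \<times> {0..1}"
proof -
  have "limit_set A \<subseteq> level_set A 1" unfolding limit_set_def by auto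
  also have "\<dots> \<subseteq> \<Union>(cells (m 1))"
    using pattern[of 1] by (auto simp: level_set_def is_pattern_def)
  also have "\<dots> \<subseteq> {0..1} \<times> {0..1}" by (rule cells_subset_unit_square) (simp add: m_pos)
  finally show ?thesis .
qed

lemma covering_number_upper:
  assumes "0 < d" "d \<le> 1"
  shows "real (covering_number d (limit_set A)) \<le> 9 / d\<^sup>2"
proof -
  obtain C where C: "finite C" "limit_set A \<subseteq> \<Union>C" "\<And>U. U \<in> C \<Longrightarrow> bounded U \<and> diameter U \<le> d"
    "real (card C) \<le> 9 / d\<^sup>2"
    using unit_square_finite_cover[OF limit_set_subset assms] by metis
  from covering_number_le_card[OF C(1-3)] C(4) show ?thesis by linarith
qed

lemma covering_number_lower:
  assumes "0 < d" "d < 1 / real (level_width n)"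
  shows "card (level_index n) \<le> covering_number d (limit_set A)"
proof -
  let ?f = "\<lambda>(i, j). cell_centre i j (level_width n)"
  have sep: "d < dist (?f p) (?f q)" if "p \<noteq> q" for p q
    using dist_cell_centre[OF level_width_pos[of n], of "fst p" "snd p" "fst q" "snd q"] that assms(2)
    by (cases p; cases q) auto
  have "inj_on ?f (level_index n)"
    using sep assms(1) by (intro inj_onI) (metis dist_self not_less_iff_gr_or_eq)
  have "1 / real (level_width n) \<le> 1" using level_width_pos[of n] by simp
  then have "d \<le> 1" using assms by linarith
  then obtain C where C: "finite C" "limit_set A \<subseteq> \<Union>C" "\<And>U. U \<in> C \<Longrightarrow> bounded U \<and> diameter U \<le> d"
    using unit_square_finite_cover[OF limit_set_subset assms(1)] by metis
  have "card (?f ` level_index n) \<le> covering_number d (limit_set A)"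
  proof (rule card_separated_le_covering_number[OF C])
    show "?f ` level_index n \<subseteq> limit_set A" using cell_centre_in_limit_set by auto
    show "d < dist p q" if "p \<in> ?f ` level_index n" "q \<in> ?f ` level_index n" "p \<noteq> q" for p q
      using that by (elim imageE) (metis sep)
  qed
  with \<open>inj_on ?f (level_index n)\<close> show ?thesis by (simp add: card_image)
qed

text \<open>Densities bounded below by \<open>c\<close> cost at most \<open>n * ln (1 / c)\<close> in the logarithm of the number of white squares
  of level \<open>n\<close>; interpolating between consecutive levels costs at most \<open>2 * ln (m (Suc n))\<close>.  By
  \<open>lim1\<close> and \<open>lim2\<close> both are small compared with the logarithm of the scale.\<close>

lemma has_box_dimension_2:
  assumes "c > 0" and dens: "\<And>k. k \<ge> 1 \<Longrightarrow> c * (real (m k))\<^sup>2 \<le> real (card (A k))"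
    and lim1: "(\<lambda>n. real n / ln (real (level_width n))) \<longlonglongrightarrow> 0"
    and lim2: "(\<lambda>n. ln (real (m (Suc n))) / ln (real (level_width n))) \<longlonglongrightarrow> 0"
    and lim3: "filterlim (\<lambda>n. ln (real (level_width n))) at_top sequentially"
  shows "has_box_dimension (limit_set A) 2"
proof -
  define N where "N d = real (covering_number d (limit_set A))" for d
  \<comment> \<open>The two losses, relative to the logarithm of the scale.\<close>
  define E where "E n = (2 * ln (real (m (Suc n))) - real n * ln c) / ln (real (level_width n))" for n
  have E: "E \<longlonglongrightarrow> 0"
    unfolding E_def diff_divide_distrib
    using tendsto_diff[OF tendsto_mult_left[OF lim2, of 2] tendsto_mult_right[OF lim1, of "ln c"]] by simp
  have upper: "ln (N d) / (- ln d) \<le> 2 + ln 9 / (- ln d)" if d: "0 < d" "d < 1" for d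
  proof -
    have "N d \<le> 9 / d\<^sup>2" unfolding N_def using covering_number_upper d by simp
    \<comment> \<open>The logarithm is monotone only on positive numbers; one point of the limit set is a packing.\<close>
    moreover have "0 < N d"
    proof -
      obtain C where C: "finite C" "limit_set A \<subseteq> \<Union>C" "\<And>U. U \<in> C \<Longrightarrow> bounded U \<and> diameter U \<le> d"
        using unit_square_finite_cover[OF limit_set_subset d(1)] d(2) by (metis less_imp_le)
      have "card {SOME p. p \<in> limit_set A} \<le> covering_number d (limit_set A)"
        by (rule card_separated_le_covering_number[OF C]) (use limit_set_nonempty some_in_eq in auto)
      then show ?thesis by (simp add: N_def)
    qed
    ultimately have "ln (N d) \<le> ln (9 / d\<^sup>2)" by (intro ln_mono) auto
    also have "\<dots> = ln 9 - 2 * ln d" using d by (simp add: ln_div ln_realpow)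
    finally show ?thesis using d by (simp add: field_simps)
  qed
  have lower: "\<forall>\<^sub>F d in at_right 0. 2 - e \<le> ln (N d) / (- ln d)" if e: "e > 0" for e
  proof -
    have "\<forall>\<^sub>F n in sequentially. E n < e \<and> ln (real (level_width n)) > 0"
      using order_tendstoD(2)[OF E e] filterlim_at_top_dense[THEN iffD1, OF lim3]
      by (auto intro: eventually_conj)
    then obtain n0 where n0: "\<And>n. n \<ge> n0 \<Longrightarrow> E n < e \<and> ln (real (level_width n)) > 0"
      unfolding eventually_sequentially by blast
    have "2 - e \<le> ln (N d) / (- ln d)" if d: "0 < d" "d < 1 / real (level_width n0)" for d
    proof -
      have "\<exists>n. 1 / real (level_width n) \<le> d"
      proof -
        obtain n where "ln (real (level_width n)) > ln (1 / d)"
          using filterlim_at_top_dense[THEN iffD1, OF lim3]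
          by (meson eventually_sequentially order_refl)
        then have "real (level_width n) > 1 / d" using d level_width_pos[of n] by simp
        then show ?thesis using d level_width_pos[of n] by (intro exI[of _ n]) (simp add: field_simps)
      qed
      \<comment> \<open>The first level with squares of side at most \<open>d\<close>; the packing bound is used one level
        earlier, where the squares are still larger than \<open>d\<close>.\<close>
      moreover define n1 where "n1 = (LEAST n. 1 / real (level_width n) \<le> d)"
      ultimately have n1: "1 / real (level_width n1) \<le> d" and least: "\<And>l. l < n1 \<Longrightarrow> d < 1 / real (level_width l)"
        by (auto intro: LeastI_ex dest: not_less_Least)
      have mono: "level_width l \<le> level_width n0" if "l \<le> n0" for l
        using that level_width_pos[of n0] unfolding level_width_def by (intro dvd_imp_le prod_dvd_prod_subset) auto
      have "n0 < n1"
      proof (rule ccontr)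
        assume "\<not> n0 < n1"
        then have "1 / real (level_width n0) \<le> 1 / real (level_width n1)"
          using mono[of n1] level_width_pos[of n1] by (intro divide_left_mono) auto
        with n1 d show False by simp
      qed
      then obtain n where n: "n1 = Suc n" "n \<ge> n0" by (cases n1) auto
      have dn: "d < 1 / real (level_width n)" using least n by simp
      have lnM: "ln (real (level_width n)) > 0" and En: "E n < e" using n0 n by auto
      have lnd: "ln (real (level_width n)) < - ln d"
      proof -
        have "ln d < ln (1 / real (level_width n))" using d dn level_width_pos[of n] by (subst ln_less_cancel_iff) auto
        then show ?thesis using level_width_pos[of n] by (simp add: ln_div)
      qed
      have lnd': "- ln d \<le> ln (real (level_width n)) + ln (real (m (Suc n)))"
      proof -
        have "ln (1 / real (level_width (Suc n))) \<le> ln d" using n1 n d level_width_pos[of "Suc n"] by (subst ln_le_cancel_iff) auto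
        then show ?thesis using level_width_pos[of n] m_pos[of "Suc n"] by (simp add: ln_div level_width_Suc ln_mult)
      qed
      have "c ^ n * (real (level_width n))\<^sup>2 \<le> real (card (level_index n))"
        using card_level_index_ge[OF _ dens] assms(1) by simp
      also have "\<dots> \<le> N d" unfolding N_def using covering_number_lower[OF d(1) dn] by simp
      finally have "ln (c ^ n * (real (level_width n))\<^sup>2) \<le> ln (N d)"
        using assms(1) level_width_pos[of n] by (intro ln_mono) auto
      then have "real n * ln c + 2 * ln (real (level_width n)) \<le> ln (N d)"
        using assms(1) level_width_pos[of n] by (simp add: ln_mult ln_realpow)
      moreover have "2 * ln (real (m (Suc n))) - real n * ln c \<le> e * ln (real (level_width n))"
        using En lnM unfolding E_def by (simp add: field_simps)
      moreover have "e * ln (real (level_width n)) \<le> e * (- ln d)"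
        using e lnd by (intro mult_left_mono) auto
      ultimately have "(2 - e) * (- ln d) \<le> ln (N d)"
        using lnd' by (simp add: algebra_simps)
      then show ?thesis using lnd lnM by (subst pos_le_divide_eq) auto
    qed
    then show ?thesis
      using level_width_pos[of n0] by (subst eventually_at_right[of 0 1]) (auto intro!: exI[of _ "1 / real (level_width n0)"])
  qed
  have "((\<lambda>d. ln (N d) / (- ln d)) \<longlongrightarrow> 2) (at_right 0)"
  proof (rule order_tendstoI)
    fix a :: real assume "a < 2"
    then have "\<forall>\<^sub>F d in at_right 0. 2 - (2 - a) / 2 \<le> ln (N d) / (- ln d)" by (intro lower) auto
    then show "\<forall>\<^sub>F d in at_right 0. a < ln (N d) / (- ln d)"
      by eventually_elim (use \<open>a < 2\<close> in \<open>simp add: field_simps\<close>)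
  next
    fix a :: real assume "2 < a"
    have "((\<lambda>d::real. 2 + ln 9 / (- ln d)) \<longlongrightarrow> 2) (at_right 0)" by real_asymp
    then have "\<forall>\<^sub>F d::real in at_right 0. 2 + ln 9 / (- ln d) < a"
      using \<open>2 < a\<close> by (rule order_tendstoD)
    moreover have "\<forall>\<^sub>F d::real in at_right 0. 0 < d \<and> d < 1"
      by (subst eventually_at_right[of 0 1]) (auto intro: exI[of _ 1])
    ultimately show "\<forall>\<^sub>F d in at_right 0. ln (N d) / (- ln d) < a"
      by eventually_elim (use upper le_less_trans in blast)
  qed
  then show ?thesis
    unfolding has_box_dimension_def N_def
    using limit_set_nonempty bounded_subset[OF _ limit_set_subset] by (simp add: bounded_Times)
qed

end

section \<open>Snake crosses\<close>

text \<open>From \<open>snake_x 1\<close> on, consecutive turning points lie on opposite sides of the vertical axis, so the run between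
  them has length \<open>(2 * j - 1) + (2 * j - 3)\<close> for \<open>j > 1\<close>, and \<open>1\<close> for \<open>j = 1\<close>.  The smaller bound
  \<open>2 * j - 1\<close> covers both cases and sums to a square.\<close>

lemma snake_x_step:
  assumes "j \<ge> 1"
  shows "2 * int j - 1 \<le> \<bar>snake_x j - snake_x (j - 1)\<bar>"
  using assms by (cases "even j") (auto simp: snake_x_def)

text \<open>Only the horizontal runs of one of the four arms are counted, since any positive proportion
  of the grid that is uniform in \<open>k\<close> suffices.\<close>

lemma card_snake_cross_ge: "k\<^sup>2 \<le> card (snake_cross k)"
proof -
  define R where "R j = int_between (snake_x (j - 1)) (snake_x j) \<times> {2 * int j}" for j
  have card_R: "2 * j - 1 \<le> card (R j)" if "j \<in> {1..k}" for j
    using snake_x_step[of j] that by (auto simp: R_def int_between_def card_cartesian_product)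
  have "k\<^sup>2 = (\<Sum>j\<in>{1..k}. 2 * j - 1)"
    by (induction k) (auto simp: power2_eq_square)
  also have "\<dots> \<le> (\<Sum>j\<in>{1..k}. card (R j))" by (rule sum_mono) (rule card_R)
  also have "\<dots> = card (\<Union>j\<in>{1..k}. R j)"
    by (rule card_UN_disjoint[symmetric]) (auto simp: R_def int_between_def)
  also have "\<dots> = card ((\<lambda>(x, y). cell (2 * int k + 3 + x) (2 * int k + 3 + y) (4 * k + 7)) ` (\<Union>j\<in>{1..k}. R j))"
    by (rule card_image[symmetric]) (auto simp: inj_on_def cell_eq_iff)
  also have "\<dots> \<le> card (snake_cross k)"
  proof (rule card_mono)
    show "finite (snake_cross k)"
      using snake_cross_is_pattern[of k] finite_cells finite_subset by (auto simp: is_pattern_def)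
    have "(\<Union>j\<in>{1..k}. R j) \<subseteq> top_arm k" unfolding top_arm_def R_def by blast
    also have "\<dots> = (rot90 ^^ 0) ` top_arm k" by simp
    also have "\<dots> \<subseteq> snake_cross_coords k" unfolding snake_cross_coords_def by fastforce
    finally show "(\<lambda>(x, y). cell (2 * int k + 3 + x) (2 * int k + 3 + y) (4 * k + 7)) ` (\<Union>j\<in>{1..k}. R j)
      \<subseteq> snake_cross k"
      unfolding snake_cross_def by auto
  qed
  finally show ?thesis .
qed

text \<open>The inductive step is \<open>n * ln (1 + 1 / n) \<le> 1\<close>.\<close>

lemma ln_fact_ge: "real n * ln (real n) - real n \<le> ln (fact n)"
proof (induction n)
  case (Suc n)
  show ?case
  proof (cases "n = 0")
    case False
    have "ln (real (Suc n)) = ln (real n) + ln (1 + 1 / real n)"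
      using False by (subst ln_mult_pos[symmetric]) (auto simp: distrib_left add_pos_pos)
    also have "\<dots> \<le> ln (real n) + 1 / real n"
      using ln_add_one_self_le_self[of "1 / real n"] by simp
    finally have "real n * ln (real (Suc n)) \<le> real n * (ln (real n) + 1 / real n)"
      by (rule mult_left_mono) simp
    then have "real n * ln (real (Suc n)) \<le> real n * ln (real n) + 1"
      using False by (simp add: distrib_left)
    moreover have "ln (fact (Suc n)) = ln (real (Suc n)) + ln (fact n :: real)"
      by (simp only: fact_Suc of_nat_mult) (subst ln_mult_pos, auto)
    moreover have "real (Suc n) * ln (real (Suc n)) = real n * ln (real (Suc n)) + ln (real (Suc n))"
      by (simp add: distrib_right)
    ultimately show ?thesis using Suc by simp
  qed simp
qed simp

interpretation snake: centred_patterns snake_cross "\<lambda>k. 4 * k + 7" "\<lambda>k. 2 * k + 3"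
proof
  fix k :: nat
  show "is_pattern (4 * k + 7) (snake_cross k)" by (rule snake_cross_is_pattern)
  show "4 * k + 7 = 2 * (2 * k + 3) + 1" by simp
  show "cell (int (2 * k + 3)) (int (2 * k + 3)) (4 * k + 7) \<in> snake_cross k"
    unfolding snake_cross_def snake_cross_coords_def
    by (intro CollectI exI[of _ 0]) auto
qed

theorem corollary1: "has_box_dimension (limit_set snake_cross) 2"
proof (rule snake.has_box_dimension_2)
  \<comment> \<open>From \<open>4 * k + 7 \<le> 11 * k\<close> for \<open>k \<ge> 1\<close>.\<close>
  show "(0::real) < 1 / 121" by simp
  fix k :: nat assume "k \<ge> 1"
  then have "4 * k + 7 \<le> 11 * k" by simp
  then have "(4 * k + 7)\<^sup>2 \<le> (11 * k)\<^sup>2" by (rule power_mono) simp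
  then have "(4 * k + 7)\<^sup>2 \<le> 121 * card (snake_cross k)"
    using card_snake_cross_ge[of k] by (simp add: power_mult_distrib)
  then have "real ((4 * k + 7)\<^sup>2) \<le> real (121 * card (snake_cross k))" by (rule of_nat_mono)
  then show "1 / 121 * (real (4 * k + 7))\<^sup>2 \<le> real (card (snake_cross k))" by simp
next
  have lnM: "real n * ln (real n) - real n \<le> ln (real (snake.level_width n))" for n
  proof -
    have "fact n \<le> snake.level_width n"
      unfolding snake.level_width_def fact_prod of_nat_id by (rule prod_mono) auto
    then have "ln (fact n) \<le> ln (real (snake.level_width n))"
      by (metis fact_gt_zero ln_mono of_nat_fact of_nat_mono)
    with ln_fact_ge[of n] show ?thesis by linarith
  qed
  \<comment> \<open>All three limits follow by comparison with this minorant of \<open>ln (level_width n)\<close>.\<close>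
  let ?g = "\<lambda>n. real n * ln (real n) - real n"
  have g: "filterlim ?g at_top sequentially" by real_asymp
  show "filterlim (\<lambda>n. ln (real (snake.level_width n))) at_top sequentially"
    by (rule filterlim_at_top_mono[OF g]) (simp add: lnM)
  have *: "(\<lambda>n. f n / ln (real (snake.level_width n))) \<longlonglongrightarrow> 0"
    if "\<And>n. 0 \<le> f n" "(\<lambda>n. f n / ?g n) \<longlonglongrightarrow> 0" for f
  proof (rule tendsto_sandwich[OF _ _ tendsto_const that(2)])
    have ev: "\<forall>\<^sub>F n in sequentially. 0 < ?g n" using g filterlim_at_top_dense[of ?g sequentially] by (elim iffD1[THEN spec])
    then show "\<forall>\<^sub>F n in sequentially. 0 \<le> f n / ln (real (snake.level_width n))"
    proof eventually_elim
      case (elim n)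
      then show ?case using that(1)[of n] lnM[of n] by simp
    qed
    from ev show "\<forall>\<^sub>F n in sequentially. f n / ln (real (snake.level_width n)) \<le> f n / ?g n"
    proof eventually_elim
      case (elim n)
      then show ?case using that(1)[of n] lnM[of n] by (intro divide_left_mono mult_pos_pos) linarith+
    qed
  qed
  show "(\<lambda>n. real n / ln (real (snake.level_width n))) \<longlonglongrightarrow> 0"
    by (rule *) (simp, real_asymp)
  show "(\<lambda>n. ln (real (4 * Suc n + 7)) / ln (real (snake.level_width n))) \<longlonglongrightarrow> 0"
    by (rule *) (simp, real_asymp)
qed

end
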